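(* Let $(M,\lambda_i(x,y),F(x,y))$ be an FP-space. The Cartan (Miron), Berwald and dual connections can be expressed in terms of the canonical connection $D=(\Gamma^\alpha_{\mu\nu},N^\alpha_\mu,C^\alpha_{\mu\nu})$ as follows: (a) the Cartan connection $(\overset{\circ}{\Gamma}{}^\alpha_{\mu\nu},N^\alpha_\mu,\overset{\circ}{C}{}^\alpha_{\mu\nu})$ is given by $\overset{\circ}{\Gamma}{}^\alpha_{\mu\nu}=\Gamma^\alpha_{\mu\nu}-A^\alpha_{\mu\nu}$ and $\overset{\circ}{C}{}^\alpha_{\mu\nu}=C^\alpha_{\mu\nu}-B^\alpha_{\mu\nu}$; (b) the Berwald connection $(G^\alpha_{\mu\nu},N^\alpha_\mu,0)$ is given by $G^\alpha_{\mu\nu}=\Gamma^\alpha_{\mu\nu}+P^\alpha_{\mu\nu}$; (c) the dual connection $(\widetilde\Gamma^\alpha_{\mu\nu},N^\alpha_\mu,\widetilde C^\alpha_{\mu\nu})$ is given by $\widetilde\Gamma^\alpha_{\mu\nu}=\Gamma^\alpha_{\nu\mu}$ and $\widetilde C^\alpha_{\mu\nu}=C^\alpha_{\nu\mu}$.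
   Context: $M$ is a smooth $n$-dimensional manifold, $\pi:TM\to M$, $\tau M:=TM\setminus\{0\}$, $(x^\mu,y^\mu)$ the induced coordinates on $TM$, $\partial_\mu:=\partial/\partial x^\mu$, $\dot\partial_\mu:=\partial/\partial y^\mu$. Repeated indices (Greek, and the Latin index $i=1,\dots,n$) are summed. All objects live on $\tau M$. The pullback bundle $\pi^{-1}(TM)$ has fibre $T_xM$ over $(x,y)$; its sections have components $X^\alpha(x,y)$ transforming like vectors on $M$. FP-space $(M,\lambda_i,F)$: $M$ together with $n$ global sections $\lambda_i$ of $\pi^{-1}(TM)$, smooth over $\tau M$ and linearly independent at each point, with components $\lambda_i^\alpha$ and inverse matrix $(\lambda_{i\alpha})$, such that, with $g_{\mu\nu}:=\lambda_{i\mu}\lambda_{i\nu}$: (1) $\dot\partial_\alpha g_{\mu\nu}$ is totally symmetric; (2) each $\lambda_i$ is positively homogeneous of degree zero in $y$; and $F:=\sqrt{g_{\mu\nu}y^\mu y^\nu}$. $g^{\mu\nu}$ is the inverse of $g_{\mu\nu}$. $\gamma^\alpha_{\mu\nu}:=\frac12g^{\alpha\eta}(\partial_\mu g_{\nu\eta}+\partial_\nu g_{\mu\eta}-\partial_\eta g_{\mu\nu})$; $G^\alpha:=\frac12\gamma^\alpha_{\mu\nu}y^\mu y^\nu$; Barthel connection $N^\alpha_\beta:=\dot\partial_\beta G^\alpha$ (the nonlinear connection of all connections here); $\delta_\mu:=\partial_\mu-N^\alpha_\mu\dot\partial_\alpha$. Berwald coefficients: $G^\alpha_{\mu\nu}:=\dot\partial_\nu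 N^\alpha_\mu$. Cartan (Miron) coefficients: $\overset{\circ}{\Gamma}{}^\alpha_{\mu\nu}:=\frac12g^{\alpha\eta}(\delta_\mu g_{\nu\eta}+\delta_\nu g_{\mu\eta}-\delta_\eta g_{\mu\nu})$, $\overset{\circ}{C}{}^\alpha_{\mu\nu}:=\frac12g^{\alpha\eta}(\dot\partial_\mu g_{\nu\eta}+\dot\partial_\nu g_{\mu\eta}-\dot\partial_\eta g_{\mu\nu})$. Canonical connection: $\Gamma^\alpha_{\mu\nu}=\lambda_i^\alpha\,\delta_\nu\lambda_{i\mu}$, $C^\alpha_{\mu\nu}=\lambda_i^\alpha\,\dot\partial_\nu\lambda_{i\mu}$. Contortion tensors: $A^\alpha_{\mu\nu}:=\lambda_i^\alpha\big(\delta_\nu\lambda_{i\mu}-\lambda_{i\eta}\overset{\circ}{\Gamma}{}^\eta_{\mu\nu}\big)$ and $B^\alpha_{\mu\nu}:=\lambda_i^\alpha\big(\dot\partial_\nu\lambda_{i\mu}-\lambda_{i\eta}\overset{\circ}{C}{}^\eta_{\mu\nu}\big)$ (the brackets being the $h$- and $v$-covariant derivatives of $\lambda_{i\mu}$ with respect to the Cartan (Miron) connection). $P^\alpha_{\mu\nu}:=\dot\partial_\nu N^\alpha_\mu-\Gamma^\alpha_{\mu\nu}$ is the $(v)hv$-torsion of the canonical connection. Dual connection: the Finsler connection with the same nonlinear connection $N$ and the coefficients of the canonical connection with the two lower indices interchanged. *)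

theory Defs
  imports "HOL-Analysis.Analysis"
begin

section \<open>Smooth manifolds and their tangent spaces\<close>

text \<open>Meant for open \<open>S\<close>. In finite dimensions, \<open>f\<close> is of class \<open>C\<^sup>k\<^sup>+\<^sup>1\<close> iff it is
  differentiable with all its directional derivatives of class \<open>C\<^sup>k\<close>.\<close>

primrec Ck_on :: "nat \<Rightarrow> ('a::euclidean_space \<Rightarrow> 'b::euclidean_space) \<Rightarrow> 'a set \<Rightarrow> bool" where
  "Ck_on 0 f S \<longleftrightarrow> continuous_on S f"
| "Ck_on (Suc k) f S \<longleftrightarrow>
     (\<forall>x\<in>S. f differentiable (at x)) \<and> (\<forall>v. Ck_on k (\<lambda>x. frechet_derivative f (at x) v) S)"

definition smooth_on :: "('a::euclidean_space \<Rightarrow> 'b::euclidean_space) \<Rightarrow> 'a set \<Rightarrow> bool" where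
  "smooth_on f S \<longleftrightarrow> (\<forall>k. Ck_on k f S)"

text \<open>A chart is a pair of a domain and a coordinate map; the values of the map outside the domain
  are irrelevant. The dimension of the manifold is \<open>CARD('n)\<close>.\<close>

type_synonym ('m, 'n) chart = "'m set \<times> ('m \<Rightarrow> real ^ 'n)"

definition is_chart :: "'m topology \<Rightarrow> ('m, 'n::finite) chart \<Rightarrow> bool" where
  "is_chart M c \<longleftrightarrow> openin M (fst c) \<and> open (snd c ` fst c) \<and>
     homeomorphic_map (subtopology M (fst c)) (top_of_set (snd c ` fst c)) (snd c)"

definition chart_inv :: "('m, 'n::finite) chart \<Rightarrow> real ^ 'n \<Rightarrow> 'm" where
  "chart_inv c = inv_into (fst c) (snd c)"

definition transition :: "('m, 'n::finite) chart \<Rightarrow> ('m, 'n) chart \<Rightarrow> real ^ 'n \<Rightarrow> real ^ 'n" where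
  "transition c d = snd d \<circ> chart_inv c"

locale smooth_manifold =
  fixes M :: "'m topology" and \<A> :: "('m, 'n::finite) chart set"
  assumes Hausdorff: "Hausdorff_space M"
    and second_countable: "second_countable M"
    and charts: "c \<in> \<A> \<Longrightarrow> is_chart M c"
    and cover: "(\<Union>c\<in>\<A>. fst c) = topspace M"
    and compatible: "\<lbrakk>c \<in> \<A>; d \<in> \<A>\<rbrakk> \<Longrightarrow> smooth_on (transition c d) (snd c ` (fst c \<inter> fst d))"

text \<open>A tangent vector at \<open>p\<close> is the family of its component vectors in all charts around \<open>p\<close>,
  related by the Jacobians of the transition maps. It is set to \<open>0\<close> at all other charts, so that
  equality of functions is equality of tangent vectors.\<close>

type_synonym ('m, 'n) tvec = "('m, 'n) chart \<Rightarrow> real ^ 'n"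

definition tangent_space :: "('m, 'n::finite) chart set \<Rightarrow> 'm \<Rightarrow> ('m, 'n) tvec set" where
  "tangent_space \<A> p = {v.
     (\<forall>c\<in>\<A>. \<forall>d\<in>\<A>. p \<in> fst c \<inter> fst d \<longrightarrow>
        v d = frechet_derivative (transition c d) (at (snd c p)) (v c)) \<and>
     (\<forall>c. \<not> (c \<in> \<A> \<and> p \<in> fst c) \<longrightarrow> v c = 0)}"

definition slit_tangent_space :: "('m, 'n::finite) chart set \<Rightarrow> 'm \<Rightarrow> ('m, 'n) tvec set" where
  "slit_tangent_space \<A> p = tangent_space \<A> p - {\<lambda>_. 0}"

text \<open>The tangent vector with induced coordinates \<open>(x, y)\<close> in the chart \<open>c\<close>.\<close>

definition tvec_of :: "('m, 'n::finite) chart set \<Rightarrow> ('m, 'n) chart \<Rightarrow>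
    (real ^ 'n) \<times> (real ^ 'n) \<Rightarrow> ('m, 'n) tvec" where
  "tvec_of \<A> c = (\<lambda>(x, y) d. if d \<in> \<A> \<and> chart_inv c x \<in> fst d
     then frechet_derivative (transition c d) (at x) y else 0)"

text \<open>The part of the slit tangent bundle over the domain of \<open>c\<close>, in induced coordinates.\<close>

definition slit_domain :: "('m, 'n::finite) chart \<Rightarrow> ((real ^ 'n) \<times> (real ^ 'n)) set" where
  "slit_domain c = (snd c ` fst c) \<times> (- {0})"

section \<open>Local objects determined by a frame\<close>

text \<open>Below, \<open>L i (x, y) $ \<alpha>\<close> is the component \<open>\<lambda>\<^sub>i\<^sup>\<alpha>(x, y)\<close> of the frame in some chart.
  Index arguments come in the order upper index, lower indices, e.g. \<open>canonical_h L \<alpha> \<mu> \<nu>\<close>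
  is the coefficient with upper index \<open>\<alpha>\<close> and lower indices \<open>\<mu> \<nu>\<close>.\<close>

type_synonym 'n pt = "(real ^ 'n) \<times> (real ^ 'n)"
type_synonym 'n frame = "'n \<Rightarrow> 'n pt \<Rightarrow> real ^ 'n"

definition dx :: "'n::finite \<Rightarrow> ('n pt \<Rightarrow> real) \<Rightarrow> 'n pt \<Rightarrow> real" where
  "dx \<mu> f z = deriv (\<lambda>t. f (fst z + t *\<^sub>R axis \<mu> 1, snd z)) 0"

definition dy :: "'n::finite \<Rightarrow> ('n pt \<Rightarrow> real) \<Rightarrow> 'n pt \<Rightarrow> real" where
  "dy \<mu> f z = deriv (\<lambda>t. f (fst z, snd z + t *\<^sub>R axis \<mu> 1)) 0"

text \<open>\<open>\<lambda>\<^sub>i\<^sub>\<alpha>\<close>; normalised by \<open>\<Sum>\<^sub>\<alpha> \<lambda>\<^sub>i\<^sup>\<alpha> \<lambda>\<^sub>j\<^sub>\<alpha> = \<delta>\<^sub>i\<^sub>j\<close>, hence the order of the indices of the inverse matrix.\<close>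

definition coframe :: "'n::finite frame \<Rightarrow> 'n \<Rightarrow> 'n \<Rightarrow> 'n pt \<Rightarrow> real" where
  "coframe L i \<alpha> z = matrix_inv (\<chi> j \<beta>. L j z $ \<beta>) $ \<alpha> $ i"

definition metric :: "'n::finite frame \<Rightarrow> 'n \<Rightarrow> 'n \<Rightarrow> 'n pt \<Rightarrow> real" where
  "metric L \<mu> \<nu> z = (\<Sum>i\<in>UNIV. coframe L i \<mu> z * coframe L i \<nu> z)"

definition metric_inv :: "'n::finite frame \<Rightarrow> 'n \<Rightarrow> 'n \<Rightarrow> 'n pt \<Rightarrow> real" where
  "metric_inv L \<mu> \<nu> z = matrix_inv (\<chi> \<alpha> \<beta>. metric L \<alpha> \<beta> z) $ \<mu> $ \<nu>"

definition christoffel :: "'n::finite frame \<Rightarrow> 'n \<Rightarrow> 'n \<Rightarrow> 'n \<Rightarrow> 'n pt \<Rightarrow> real" where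
  "christoffel L \<alpha> \<mu> \<nu> z = 1/2 * (\<Sum>\<eta>\<in>UNIV. metric_inv L \<alpha> \<eta> z *
     (dx \<mu> (metric L \<nu> \<eta>) z + dx \<nu> (metric L \<mu> \<eta>) z - dx \<eta> (metric L \<mu> \<nu>) z))"

definition spray :: "'n::finite frame \<Rightarrow> 'n \<Rightarrow> 'n pt \<Rightarrow> real" where
  "spray L \<alpha> z = 1/2 * (\<Sum>\<mu>\<in>UNIV. \<Sum>\<nu>\<in>UNIV. christoffel L \<alpha> \<mu> \<nu> z * snd z $ \<mu> * snd z $ \<nu>)"

definition barthel :: "'n::finite frame \<Rightarrow> 'n \<Rightarrow> 'n \<Rightarrow> 'n pt \<Rightarrow> real" where
  "barthel L \<alpha> \<beta> z = dy \<beta> (spray L \<alpha>) z"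

definition delta :: "'n::finite frame \<Rightarrow> 'n \<Rightarrow> ('n pt \<Rightarrow> real) \<Rightarrow> 'n pt \<Rightarrow> real" where
  "delta L \<mu> f z = dx \<mu> f z - (\<Sum>\<alpha>\<in>UNIV. barthel L \<alpha> \<mu> z * dy \<alpha> f z)"

definition berwald_h :: "'n::finite frame \<Rightarrow> 'n \<Rightarrow> 'n \<Rightarrow> 'n \<Rightarrow> 'n pt \<Rightarrow> real" where
  "berwald_h L \<alpha> \<mu> \<nu> z = dy \<nu> (barthel L \<alpha> \<mu>) z"

definition cartan_h :: "'n::finite frame \<Rightarrow> 'n \<Rightarrow> 'n \<Rightarrow> 'n \<Rightarrow> 'n pt \<Rightarrow> real" where
  "cartan_h L \<alpha> \<mu> \<nu> z = 1/2 * (\<Sum>\<eta>\<in>UNIV. metric_inv L \<alpha> \<eta> z *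
     (delta L \<mu> (metric L \<nu> \<eta>) z + delta L \<nu> (metric L \<mu> \<eta>) z - delta L \<eta> (metric L \<mu> \<nu>) z))"

definition cartan_v :: "'n::finite frame \<Rightarrow> 'n \<Rightarrow> 'n \<Rightarrow> 'n \<Rightarrow> 'n pt \<Rightarrow> real" where
  "cartan_v L \<alpha> \<mu> \<nu> z = 1/2 * (\<Sum>\<eta>\<in>UNIV. metric_inv L \<alpha> \<eta> z *
     (dy \<mu> (metric L \<nu> \<eta>) z + dy \<nu> (metric L \<mu> \<eta>) z - dy \<eta> (metric L \<mu> \<nu>) z))"

definition canonical_h :: "'n::finite frame \<Rightarrow> 'n \<Rightarrow> 'n \<Rightarrow> 'n \<Rightarrow> 'n pt \<Rightarrow> real" where
  "canonical_h L \<alpha> \<mu> \<nu> z = (\<Sum>i\<in>UNIV. L i z $ \<alpha> * delta L \<nu> (coframe L i \<mu>) z)"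

definition canonical_v :: "'n::finite frame \<Rightarrow> 'n \<Rightarrow> 'n \<Rightarrow> 'n \<Rightarrow> 'n pt \<Rightarrow> real" where
  "canonical_v L \<alpha> \<mu> \<nu> z = (\<Sum>i\<in>UNIV. L i z $ \<alpha> * dy \<nu> (coframe L i \<mu>) z)"

text \<open>The \<open>h\<close>- and \<open>v\<close>-contortion; the brackets are the covariant derivatives of the coframe with
  respect to the Cartan connection.\<close>

definition contortion_h :: "'n::finite frame \<Rightarrow> 'n \<Rightarrow> 'n \<Rightarrow> 'n \<Rightarrow> 'n pt \<Rightarrow> real" where
  "contortion_h L \<alpha> \<mu> \<nu> z = (\<Sum>i\<in>UNIV. L i z $ \<alpha> *
     (delta L \<nu> (coframe L i \<mu>) z - (\<Sum>\<eta>\<in>UNIV. coframe L i \<eta> z * cartan_h L \<eta> \<mu> \<nu> z)))"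

definition contortion_v :: "'n::finite frame \<Rightarrow> 'n \<Rightarrow> 'n \<Rightarrow> 'n \<Rightarrow> 'n pt \<Rightarrow> real" where
  "contortion_v L \<alpha> \<mu> \<nu> z = (\<Sum>i\<in>UNIV. L i z $ \<alpha> *
     (dy \<nu> (coframe L i \<mu>) z - (\<Sum>\<eta>\<in>UNIV. coframe L i \<eta> z * cartan_v L \<eta> \<mu> \<nu> z)))"

definition hv_torsion :: "'n::finite frame \<Rightarrow> 'n \<Rightarrow> 'n \<Rightarrow> 'n \<Rightarrow> 'n pt \<Rightarrow> real" where
  "hv_torsion L \<alpha> \<mu> \<nu> z = dy \<nu> (barthel L \<alpha> \<mu>) z - canonical_h L \<alpha> \<mu> \<nu> z"

text \<open>Finsler connections are given by their coefficients in each chart at each point of the slit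
  tangent bundle: horizontal coefficients, nonlinear connection, vertical coefficients.\<close>

type_synonym 'n finsler_coeffs =
  "('n \<Rightarrow> 'n \<Rightarrow> 'n \<Rightarrow> real) \<times> ('n \<Rightarrow> 'n \<Rightarrow> real) \<times> ('n \<Rightarrow> 'n \<Rightarrow> 'n \<Rightarrow> real)"

definition canonical_connection :: "'n::finite frame \<Rightarrow> 'n pt \<Rightarrow> 'n finsler_coeffs" where
  "canonical_connection L z =
     (\<lambda>\<alpha> \<mu> \<nu>. canonical_h L \<alpha> \<mu> \<nu> z, \<lambda>\<alpha> \<mu>. barthel L \<alpha> \<mu> z, \<lambda>\<alpha> \<mu> \<nu>. canonical_v L \<alpha> \<mu> \<nu> z)"

definition cartan_connection :: "'n::finite frame \<Rightarrow> 'n pt \<Rightarrow> 'n finsler_coeffs" where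
  "cartan_connection L z =
     (\<lambda>\<alpha> \<mu> \<nu>. cartan_h L \<alpha> \<mu> \<nu> z, \<lambda>\<alpha> \<mu>. barthel L \<alpha> \<mu> z, \<lambda>\<alpha> \<mu> \<nu>. cartan_v L \<alpha> \<mu> \<nu> z)"

definition berwald_connection :: "'n::finite frame \<Rightarrow> 'n pt \<Rightarrow> 'n finsler_coeffs" where
  "berwald_connection L z =
     (\<lambda>\<alpha> \<mu> \<nu>. berwald_h L \<alpha> \<mu> \<nu> z, \<lambda>\<alpha> \<mu>. barthel L \<alpha> \<mu> z, \<lambda>\<alpha> \<mu> \<nu>. 0)"

definition dual_connection :: "'n::finite frame \<Rightarrow> 'n pt \<Rightarrow> 'n finsler_coeffs" where
  "dual_connection L z =
     (\<lambda>\<alpha> \<mu> \<nu>. canonical_h L \<alpha> \<nu> \<mu> z, \<lambda>\<alpha> \<mu>. barthel L \<alpha> \<mu> z, \<lambda>\<alpha> \<mu> \<nu>. canonical_v L \<alpha> \<nu> \<mu> z)"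

section \<open>FP-spaces\<close>

definition totally_symmetric :: "('n \<Rightarrow> 'n \<Rightarrow> 'n \<Rightarrow> real) \<Rightarrow> bool" where
  "totally_symmetric T \<longleftrightarrow> (\<forall>\<alpha> \<beta> \<gamma>. T \<alpha> \<beta> \<gamma> = T \<beta> \<alpha> \<gamma> \<and> T \<alpha> \<beta> \<gamma> = T \<alpha> \<gamma> \<beta>)"

text \<open>A section of the pullback bundle maps a base point \<open>p\<close> and a nonzero tangent vector at \<open>p\<close>
  to a tangent vector at \<open>p\<close>.\<close>

type_synonym ('m, 'n) pullback_section = "'m \<Rightarrow> ('m, 'n) tvec \<Rightarrow> ('m, 'n) tvec"

definition frame_components :: "('m, 'n::finite) chart set \<Rightarrow> ('n \<Rightarrow> ('m, 'n) pullback_section) \<Rightarrow>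
    ('m, 'n) chart \<Rightarrow> 'n frame" where
  "frame_components \<A> lam c i z = lam i (chart_inv c (fst z)) (tvec_of \<A> c z) c"

locale fp_space = smooth_manifold M \<A>
  for M :: "'m topology" and \<A> :: "('m, 'n::finite) chart set" +
  fixes lam :: "'n \<Rightarrow> ('m, 'n) pullback_section"
    and F :: "'m \<Rightarrow> ('m, 'n) tvec \<Rightarrow> real"
  assumes frame_section:
      "\<lbrakk>p \<in> topspace M; v \<in> slit_tangent_space \<A> p\<rbrakk> \<Longrightarrow> lam i p v \<in> tangent_space \<A> p"
    and frame_smooth: "c \<in> \<A> \<Longrightarrow> smooth_on (frame_components \<A> lam c i) (slit_domain c)"
    and frame_independent:
      "\<lbrakk>p \<in> topspace M; v \<in> slit_tangent_space \<A> p; \<And>c. (\<Sum>j\<in>UNIV. a j *\<^sub>R lam j p v c) = 0\<rbrakk>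
        \<Longrightarrow> a i = (0::real)"
    and dy_metric_symmetric:
      "\<lbrakk>c \<in> \<A>; z \<in> slit_domain c\<rbrakk>
        \<Longrightarrow> totally_symmetric (\<lambda>\<alpha> \<mu> \<nu>. dy \<alpha> (metric (frame_components \<A> lam c) \<mu> \<nu>) z)"
    and frame_homogeneous:
      "\<lbrakk>p \<in> topspace M; v \<in> slit_tangent_space \<A> p; t > 0\<rbrakk>
        \<Longrightarrow> lam i p (\<lambda>c. t *\<^sub>R v c) = lam i p v"
    and F_eq:
      "\<lbrakk>c \<in> \<A>; p \<in> fst c; v \<in> slit_tangent_space \<A> p\<rbrakk>
        \<Longrightarrow> F p v = sqrt (\<Sum>\<mu>\<in>UNIV. \<Sum>\<nu>\<in>UNIV.
              metric (frame_components \<A> lam c) \<mu> \<nu> (snd c p, v c) * v c $ \<mu> * v c $ \<nu>)"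

end

theory Submission
  imports Defs
begin

text \<open>
  Parts (b) and (c) hold by definition: the torsion \<open>P\<close> is the difference of the Berwald and the
  canonical coefficients, and the dual connection is the canonical one with its lower indices
  swapped. Part (a) rests on the duality \<open>\<Sum>\<^sub>i \<lambda>\<^sub>i\<^sup>\<alpha> \<lambda>\<^sub>i\<^sub>\<eta> = \<delta>\<^sup>\<alpha>\<^sub>\<eta>\<close>: expanding the bracket in the
  definition of the contortion, the first term yields the canonical coefficient and the second one
  contracts, by duality, to the Cartan coefficient. So the contortion is the canonical minus the
  Cartan coefficient, horizontally (\<open>contortion_h_eq\<close>) and vertically (\<open>contortion_v_eq\<close>).

  Duality requires the matrix of frame components to be invertible at every point of every chart,
  while the frame is given on the manifold and its independence speaks of tangent vectors, that
  is, of their components in all charts at once. The bulk of the proof is this passage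
  (\<open>frame_matrix_invertible\<close>). The induced coordinates \<open>(x, y)\<close> with \<open>y \<noteq> 0\<close> represent a genuine
  nonzero tangent vector, because the Jacobians of the transition maps satisfy the cocycle
  condition; and a linear relation among the components in one chart propagates to all others,
  because tangent vectors transform linearly.
\<close>

lemma chart_inv_in_domain:
  assumes "x \<in> snd c ` fst c"
  shows "chart_inv c x \<in> fst c" "snd c (chart_inv c x) = x"
  using assms unfolding chart_inv_def by (auto intro: inv_into_into f_inv_into_f)

lemma chart_inj_on:
  assumes "is_chart M c"
  shows "inj_on (snd c) (fst c)"
proof -
  have "topspace (subtopology M (fst c)) = fst c"
    using assms openin_subset unfolding is_chart_def by (fastforce simp: topspace_subtopology)
  then show ?thesis
    using assms homeomorphic_imp_injective_map unfolding is_chart_def by metis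
qed

lemma chart_inv_of_chart:
  assumes "is_chart M c" "p \<in> fst c"
  shows "chart_inv c (snd c p) = p"
  using chart_inj_on[OF assms(1)] assms(2) unfolding chart_inv_def by (rule inv_into_f_f)

lemma transition_at_chart:
  assumes "is_chart M c" "p \<in> fst c"
  shows "transition c d (snd c p) = snd d p"
  by (simp add: transition_def chart_inv_of_chart[OF assms])

lemma open_chart_image_overlap:
  assumes c: "is_chart M c" and d: "is_chart M d"
  shows "open (snd c ` (fst c \<inter> fst d))"
proof -
  have "openin (subtopology M (fst c)) (fst c \<inter> fst d)"
    using c d unfolding is_chart_def by (metis openin_subtopology_Int2)
  then have "openin (top_of_set (snd c ` fst c)) (snd c ` (fst c \<inter> fst d))"
    using c homeomorphic_imp_open_map unfolding is_chart_def open_map_def by blast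
  then show ?thesis
    using c unfolding is_chart_def by (metis openin_open_trans)
qed

lemma smooth_on_imp_differentiable:
  assumes "smooth_on f S" "x \<in> S"
  shows "f differentiable (at x)"
  using assms unfolding smooth_on_def by (metis Ck_on.simps(2))

context smooth_manifold
begin

lemma transition_differentiable:
  assumes "c \<in> \<A>" "d \<in> \<A>" "p \<in> fst c \<inter> fst d"
  shows "transition c d differentiable (at (snd c p))"
  using compatible[OF assms(1,2)] assms(3) by (blast intro: smooth_on_imp_differentiable)

lemma frechet_derivative_transition_self:
  assumes "c \<in> \<A>" "p \<in> fst c"
  shows "frechet_derivative (transition c c) (at (snd c p)) = id"
proof -
  have o: "open (snd c ` fst c)" using charts[OF assms(1)] by (simp add: is_chart_def)
  have "((\<lambda>x. x) has_derivative id) (at (snd c p))"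
    by (simp add: id_def)
  then have "(transition c c has_derivative id) (at (snd c p))"
    by (rule has_derivative_transform_within_open[OF _ o])
       (use assms in \<open>auto simp: transition_at_chart[OF charts[OF assms(1)]]\<close>)
  then show ?thesis using frechet_derivative_at by force
qed

text \<open>The cocycle condition, by the chain rule: on the triple overlap, which is open, the transition
  from \<open>c\<close> to \<open>e\<close> is the composite of those from \<open>c\<close> to \<open>d\<close> and from \<open>d\<close> to \<open>e\<close>.\<close>

lemma frechet_derivative_transition_cocycle:
  assumes A: "c \<in> \<A>" "d \<in> \<A>" "e \<in> \<A>" and p: "p \<in> fst c" "p \<in> fst d" "p \<in> fst e"
  shows "frechet_derivative (transition c e) (at (snd c p)) =
    frechet_derivative (transition d e) (at (snd d p)) \<circ>
    frechet_derivative (transition c d) (at (snd c p))"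
proof -
  let ?U = "snd c ` (fst c \<inter> fst d) \<inter> snd c ` (fst c \<inter> fst e)"
  note ch = charts[OF A(1)] charts[OF A(2)] charts[OF A(3)]
  have o: "open ?U" using open_chart_image_overlap ch by (intro open_Int) blast+
  have eq: "(transition d e \<circ> transition c d) x = transition c e x" if x: "x \<in> ?U" for x
  proof -
    obtain q where q: "q \<in> fst c" "q \<in> fst d" "x = snd c q" using x by blast
    moreover have "q \<in> fst e" using x q chart_inj_on[OF ch(1)] by (auto dest: inj_onD)
    ultimately show ?thesis using ch by (simp add: transition_at_chart)
  qed
  have "(transition c d has_derivative frechet_derivative (transition c d) (at (snd c p)))
      (at (snd c p))"
    using transition_differentiable[of c d p] A p by (simp add: frechet_derivative_works)
  moreover have "(transition d e has_derivative frechet_derivative (transition d e) (at (snd d p)))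
      (at (transition c d (snd c p)))"
    using transition_differentiable[of d e p] A p ch
    by (simp add: frechet_derivative_works transition_at_chart)
  ultimately have "(transition d e \<circ> transition c d has_derivative
      frechet_derivative (transition d e) (at (snd d p)) \<circ>
      frechet_derivative (transition c d) (at (snd c p))) (at (snd c p))"
    by (rule diff_chain_at)
  then have "(transition c e has_derivative
      frechet_derivative (transition d e) (at (snd d p)) \<circ>
      frechet_derivative (transition c d) (at (snd c p))) (at (snd c p))"
    by (rule has_derivative_transform_within_open[OF _ o]) (use p eq in auto)
  then show ?thesis using frechet_derivative_at by force
qed

lemma tvec_of_own_chart:
  assumes "c \<in> \<A>" "p \<in> fst c"
  shows "tvec_of \<A> c (snd c p, y) c = y"
  using assms
  by (simp add: tvec_of_def chart_inv_of_chart[OF charts] frechet_derivative_transition_self)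

lemma tvec_of_in_tangent_space:
  assumes "c \<in> \<A>" "p \<in> fst c"
  shows "tvec_of \<A> c (snd c p, y) \<in> tangent_space \<A> p"
proof -
  let ?v = "tvec_of \<A> c (snd c p, y)"
  have inv: "chart_inv c (snd c p) = p"
    using assms by (simp add: chart_inv_of_chart[OF charts])
  have comp: "?v d = frechet_derivative (transition c d) (at (snd c p)) y"
    if "d \<in> \<A>" "p \<in> fst d" for d
    using that by (simp add: tvec_of_def inv)
  have "?v e = frechet_derivative (transition d e) (at (snd d p)) (?v d)"
    if "d \<in> \<A>" "e \<in> \<A>" "p \<in> fst d \<inter> fst e" for d e
    using frechet_derivative_transition_cocycle[of c d e p] assms that by (simp add: comp)
  moreover have "?v d = 0" if "\<not> (d \<in> \<A> \<and> p \<in> fst d)" for d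
    using that by (auto simp: tvec_of_def inv)
  ultimately show ?thesis unfolding tangent_space_def by blast
qed

lemma tvec_of_in_slit_tangent_space:
  assumes "c \<in> \<A>" "p \<in> fst c" "y \<noteq> 0"
  shows "tvec_of \<A> c (snd c p, y) \<in> slit_tangent_space \<A> p"
  using tvec_of_in_tangent_space[OF assms(1,2)] tvec_of_own_chart[OF assms(1,2), of y] assms(3)
  unfolding slit_tangent_space_def by auto

text \<open>Components in different charts are related by linear maps, so a linear relation that holds
  in one chart holds in all.\<close>

lemma tangent_relation_all_charts:
  fixes w :: "'i::finite \<Rightarrow> ('m, 'n) tvec"
  assumes c: "c \<in> \<A>" "p \<in> fst c"
    and w: "\<And>j. w j \<in> tangent_space \<A> p"
    and rel: "(\<Sum>j\<in>UNIV. a j *\<^sub>R w j c) = 0"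
  shows "(\<Sum>j\<in>UNIV. a j *\<^sub>R w j d) = 0"
proof (cases "d \<in> \<A> \<and> p \<in> fst d")
  case True
  let ?J = "frechet_derivative (transition c d) (at (snd c p))"
  have lin: "linear ?J"
    using transition_differentiable c True by (intro linear_frechet_derivative) auto
  have "w j d = ?J (w j c)" for j
    using w[of j] c True unfolding tangent_space_def by blast
  then have "(\<Sum>j\<in>UNIV. a j *\<^sub>R w j d) = ?J (\<Sum>j\<in>UNIV. a j *\<^sub>R w j c)"
    by (simp add: linear_sum[OF lin] linear_cmul[OF lin])
  then show ?thesis using rel linear_0[OF lin] by simp
next
  case False
  then have "w j d = 0" for j using w[of j] unfolding tangent_space_def by blast
  then show ?thesis by simp
qed

end

text \<open>A relation among the rows of the matrix is a relation among the components of the frame at the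
  tangent vector with coordinates \<open>z\<close>. It holds in every chart, so independence of the frame applies.\<close>

lemma (in fp_space) frame_matrix_invertible:
  assumes c: "c \<in> \<A>" and z: "z \<in> slit_domain c"
  shows "invertible (\<chi> j \<beta>. frame_components \<A> lam c j z $ \<beta>)"
proof -
  let ?L = "frame_components \<A> lam c"
  define p where "p = chart_inv c (fst z)"
  define v where "v = tvec_of \<A> c z"
  have x: "fst z \<in> snd c ` fst c" and y: "snd z \<noteq> 0"
    using z by (auto simp: slit_domain_def)
  have p: "p \<in> fst c" and z_eq: "z = (snd c p, snd z)"
    using chart_inv_in_domain[OF x] by (simp_all add: p_def)
  have pM: "p \<in> topspace M" using p c cover by blast
  have v: "v \<in> slit_tangent_space \<A> p"
    unfolding v_def by (subst z_eq) (rule tvec_of_in_slit_tangent_space[OF c p y])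
  have "a i = 0" if "(\<Sum>j\<in>UNIV. a j *\<^sub>R ?L j z) = 0" for a i
  proof (rule frame_independent[OF pM v])
    fix d
    show "(\<Sum>j\<in>UNIV. a j *\<^sub>R lam j p v d) = 0"
      using tangent_relation_all_charts[OF c p, of "\<lambda>j. lam j p v"] frame_section[OF pM v] that
      by (simp add: frame_components_def p_def v_def)
  qed
  then have "\<forall>a. (\<Sum>j\<in>UNIV. a j *s row j (\<chi> j \<beta>. ?L j z $ \<beta>)) = 0 \<longrightarrow> (\<forall>i. a i = 0)"
    by (simp add: row_def scalar_mult_eq_scaleR)
  then show ?thesis
    by (simp add: invertible_right_inverse matrix_right_invertible_independent_rows)
qed

text \<open>Since \<open>coframe L i \<eta>\<close> is the entry \<open>(\<eta>, i)\<close> of the inverse matrix, summing over \<open>i\<close> evaluates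
  the product of the inverse with the matrix, in this order.\<close>

lemma frame_coframe_duality:
  fixes L :: "'n::finite frame"
  assumes "invertible (\<chi> j \<beta>. L j z $ \<beta>)"
  shows "(\<Sum>i\<in>UNIV. L i z $ \<alpha> * coframe L i \<eta> z) = (if \<eta> = \<alpha> then 1 else 0)"
proof -
  let ?M = "\<chi> j \<beta>. L j z $ \<beta>"
  have "(\<Sum>i\<in>UNIV. L i z $ \<alpha> * coframe L i \<eta> z) = (matrix_inv ?M ** ?M) $ \<eta> $ \<alpha>"
    by (simp add: coframe_def matrix_matrix_mult_def mult.commute)
  moreover have "matrix_inv ?M ** ?M = mat 1"
    unfolding matrix_inv_def using assms unfolding invertible_def
    by (metis (mono_tags, lifting) someI_ex)
  ultimately show ?thesis by (simp add: mat_def)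
qed

lemma frame_coframe_contract:
  fixes L :: "'n::finite frame"
  assumes "invertible (\<chi> j \<beta>. L j z $ \<beta>)"
  shows "(\<Sum>i\<in>UNIV. L i z $ \<alpha> * (\<Sum>\<eta>\<in>UNIV. coframe L i \<eta> z * T \<eta>)) = T \<alpha>"
proof -
  have "(\<Sum>i\<in>UNIV. L i z $ \<alpha> * (\<Sum>\<eta>\<in>UNIV. coframe L i \<eta> z * T \<eta>)) =
      (\<Sum>\<eta>\<in>UNIV. (\<Sum>i\<in>UNIV. L i z $ \<alpha> * coframe L i \<eta> z) * T \<eta>)"
    unfolding sum_distrib_left sum_distrib_right mult.assoc by (rule sum.swap)
  also have "\<dots> = T \<alpha>"
    by (simp add: frame_coframe_duality[where L=L and z=z, OF assms]
        if_distrib[of "\<lambda>u. u * _"] cong: if_cong)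
  finally show ?thesis .
qed

lemma contortion_h_eq:
  fixes L :: "'n::finite frame"
  assumes "invertible (\<chi> j \<beta>. L j z $ \<beta>)"
  shows "contortion_h L \<alpha> \<mu> \<nu> z = canonical_h L \<alpha> \<mu> \<nu> z - cartan_h L \<alpha> \<mu> \<nu> z"
  using frame_coframe_contract[where L=L and z=z and \<alpha>=\<alpha>
      and T="\<lambda>\<eta>. cartan_h L \<eta> \<mu> \<nu> z", OF assms]
  by (simp add: contortion_h_def canonical_h_def right_diff_distrib sum_subtractf)

lemma contortion_v_eq:
  fixes L :: "'n::finite frame"
  assumes "invertible (\<chi> j \<beta>. L j z $ \<beta>)"
  shows "contortion_v L \<alpha> \<mu> \<nu> z = canonical_v L \<alpha> \<mu> \<nu> z - cartan_v L \<alpha> \<mu> \<nu> z"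
  using frame_coframe_contract[where L=L and z=z and \<alpha>=\<alpha>
      and T="\<lambda>\<eta>. cartan_v L \<eta> \<mu> \<nu> z", OF assms]
  by (simp add: contortion_v_def canonical_v_def right_diff_distrib sum_subtractf)

theorem theorem3p6:
  fixes M :: "'m topology" and \<A> :: "('m, 'n::finite) chart set"
    and lam :: "'n \<Rightarrow> ('m, 'n) pullback_section"
    and F :: "'m \<Rightarrow> ('m, 'n) tvec \<Rightarrow> real"
  assumes "fp_space M \<A> lam F"
  shows "\<forall>c\<in>\<A>. \<forall>z\<in>slit_domain c.
    (let L = frame_components \<A> lam c; (\<Gamma>, N, C) = canonical_connection L z
     in cartan_connection L z =
          (\<lambda>\<alpha> \<mu> \<nu>. \<Gamma> \<alpha> \<mu> \<nu> - contortion_h L \<alpha> \<mu> \<nu> z, N,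
           \<lambda>\<alpha> \<mu> \<nu>. C \<alpha> \<mu> \<nu> - contortion_v L \<alpha> \<mu> \<nu> z) \<and>
        berwald_connection L z =
          (\<lambda>\<alpha> \<mu> \<nu>. \<Gamma> \<alpha> \<mu> \<nu> + hv_torsion L \<alpha> \<mu> \<nu> z, N, \<lambda>\<alpha> \<mu> \<nu>. 0) \<and>
        dual_connection L z =
          (\<lambda>\<alpha> \<mu> \<nu>. \<Gamma> \<alpha> \<nu> \<mu>, N, \<lambda>\<alpha> \<mu> \<nu>. C \<alpha> \<nu> \<mu>))"
proof (intro ballI)
  fix c z assume "c \<in> \<A>" "z \<in> slit_domain c"
  then have inv: "invertible (\<chi> j \<beta>. frame_components \<A> lam c j z $ \<beta>)"
    by (rule fp_space.frame_matrix_invertible[OF assms])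
  note contortion =
    contortion_h_eq[where L="frame_components \<A> lam c" and z=z, OF inv]
    contortion_v_eq[where L="frame_components \<A> lam c" and z=z, OF inv]
  show "let L = frame_components \<A> lam c; (\<Gamma>, N, C) = canonical_connection L z
     in cartan_connection L z =
          (\<lambda>\<alpha> \<mu> \<nu>. \<Gamma> \<alpha> \<mu> \<nu> - contortion_h L \<alpha> \<mu> \<nu> z, N,
           \<lambda>\<alpha> \<mu> \<nu>. C \<alpha> \<mu> \<nu> - contortion_v L \<alpha> \<mu> \<nu> z) \<and>
        berwald_connection L z =
          (\<lambda>\<alpha> \<mu> \<nu>. \<Gamma> \<alpha> \<mu> \<nu> + hv_torsion L \<alpha> \<mu> \<nu> z, N, \<lambda>\<alpha> \<mu> \<nu>. 0) \<and>
        dual_connection L z =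
          (\<lambda>\<alpha> \<mu> \<nu>. \<Gamma> \<alpha> \<nu> \<mu>, N, \<lambda>\<alpha> \<mu> \<nu>. C \<alpha> \<nu> \<mu>)"
    by (simp add: Let_def canonical_connection_def cartan_connection_def berwald_connection_def
        dual_connection_def contortion hv_torsion_def berwald_h_def)
qed

end
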